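(* Let $k\ge 1$ be an integer. If a finite simple graph $G$ is strongly $k$-choosable, then it is also strongly $km$-choosable for every positive integer $m$.
   Context: A graph is $n$-choosable if for every assignment of sets $S(v)$ of size $n$ to its vertices there is a proper vertex colouring assigning each vertex $v$ a colour from $S(v)$. A graph $G=(V,E)$ is strongly $n$-choosable if for every collection $V_1,\dots,V_r$ of pairwise disjoint subsets of $V$, each of size at most $n$, the graph obtained from $G$ by adding all edges between distinct vertices within each $V_i$ is $n$-choosable. *)

theory Defs
  imports "Graph_Theory.Pair_Digraph" "HOL-Library.Disjoint_Sets"
begin

text \<open>Finite simple graphs are \<^const>\<open>pair_graph\<close>s: finite, loop-free, with a symmetric set of
  arcs. An undirected edge is a pair of opposite arcs.\<close>

definition proper_colouring :: "'a pair_pre_digraph \<Rightarrow> ('a \<Rightarrow> 'c) \<Rightarrow> bool" where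
  "proper_colouring G c \<longleftrightarrow> (\<forall>(u, v) \<in> parcs G. c u \<noteq> c v)"

text \<open>A definition cannot quantify over the type of colours, so colours are natural numbers. For
  finite graphs this is no restriction: see \<open>choosable_any_colours\<close> below.\<close>

definition choosable :: "nat \<Rightarrow> 'a pair_pre_digraph \<Rightarrow> bool" where
  "choosable n G \<longleftrightarrow>
    (\<forall>S :: 'a \<Rightarrow> nat set. (\<forall>v \<in> pverts G. finite (S v) \<and> card (S v) = n) \<longrightarrow>
      (\<exists>c. proper_colouring G c \<and> (\<forall>v \<in> pverts G. c v \<in> S v)))"

definition add_cliques :: "'a pair_pre_digraph \<Rightarrow> 'i set \<Rightarrow> ('i \<Rightarrow> 'a set) \<Rightarrow> 'a pair_pre_digraph" where
  "add_cliques G I V =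
    \<lparr>pverts = pverts G,
     parcs = parcs G \<union> {(u, v). u \<noteq> v \<and> (\<exists>i \<in> I. u \<in> V i \<and> v \<in> V i)}\<rparr>"

definition strongly_choosable :: "nat \<Rightarrow> 'a pair_pre_digraph \<Rightarrow> bool" where
  "strongly_choosable n G \<longleftrightarrow>
    (\<forall>(r :: nat) (V :: nat \<Rightarrow> 'a set).
      (\<forall>i \<in> {1..r}. V i \<subseteq> pverts G \<and> finite (V i) \<and> card (V i) \<le> n) \<and>
      disjoint_family_on V {1..r} \<longrightarrow>
      choosable n (add_cliques G {1..r} V))"

lemma pair_graph_add_cliques:
  assumes "pair_graph G" and "\<And>i. i \<in> I \<Longrightarrow> V i \<subseteq> pverts G"
  shows "pair_graph (add_cliques G I V)"
proof -
  interpret pair_graph G by fact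
  let ?H = "add_cliques G I V"
  have sub: "parcs ?H \<subseteq> pverts G \<times> pverts G"
    using assms(2) by (fastforce simp: add_cliques_def dest: in_arcsD1 in_arcsD2)
  have fin: "finite (parcs ?H)"
    using sub pair_finite_verts by (meson finite_SigmaI finite_subset)
  have sym: "sym (parcs ?H)"
    by (auto simp: sym_def add_cliques_def intro: arcs_symmetric)
  have verts: "pverts ?H = pverts G"
    by (simp add: add_cliques_def)
  have loops: "fst e \<noteq> snd e" if "e \<in> parcs ?H" for e
    using that by (auto simp: add_cliques_def dest: pair_no_loops)
  show ?thesis
    using sub fin sym verts loops pair_finite_verts
    by unfold_locales (auto simp: symmetric_def)
qed

lemma choosable_any_colours:
  fixes S :: "'a \<Rightarrow> 'c set"
  assumes G: "pair_graph G" and ch: "choosable n G"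
    and S: "\<And>v. v \<in> pverts G \<Longrightarrow> finite (S v) \<and> card (S v) = n"
  shows "\<exists>c. proper_colouring G c \<and> (\<forall>v \<in> pverts G. c v \<in> S v)"
proof -
  interpret pair_graph G by fact
  define U where "U = (\<Union>v \<in> pverts G. S v)"
  have "finite U"
    using S pair_finite_verts by (auto simp: U_def)
  then obtain f :: "'c \<Rightarrow> nat" where f: "inj_on f U"
    using finite_imp_inj_to_nat_seg by metis
  have sub: "S v \<subseteq> U" if "v \<in> pverts G" for v
    using that by (auto simp: U_def)
  have "\<forall>v \<in> pverts G. finite (f ` S v) \<and> card (f ` S v) = n"
    using S sub f by (metis card_image finite_imageI inj_on_subset)
  then obtain c where c: "proper_colouring G c" "\<forall>v \<in> pverts G. c v \<in> f ` S v"
    using ch[unfolded choosable_def, rule_format, of "\<lambda>v. f ` S v"] by blast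
  define d where "d v = inv_into U f (c v)" for v
  have d: "d v \<in> S v \<and> f (d v) = c v" if v: "v \<in> pverts G" for v
  proof -
    obtain x where "x \<in> S v" "c v = f x"
      using c(2) v by blast
    then show ?thesis
      using sub[OF v] f by (auto simp: d_def)
  qed
  have "d u \<noteq> d v" if "(u, v) \<in> parcs G" for u v
    using d[OF in_arcsD1[OF that]] d[OF in_arcsD2[OF that]] c(1) that
    by (fastforce simp: proper_colouring_def)
  then show ?thesis
    using d by (auto simp: proper_colouring_def)
qed

end

theory Submission
  imports Defs
begin

text \<open>Each clique \<open>V i\<close> of size at most \<open>k * m\<close> is cut into \<open>m\<close> groups of size at most \<open>k\<close>, and
  the colours are split among the groups such that every vertex finds at least \<open>k\<close> of its \<open>k * m\<close>
  colours in the share of its group. After shrinking the lists accordingly, vertices in different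
  groups of the same \<open>V i\<close> can never receive the same colour, so strong \<open>k\<close>-choosability, applied
  to the groups, yields the colouring. The splitting is a moving-knife argument: let the share
  \<open>A\<close> of the first group grow until \<open>k\<close> vertices have at least \<open>k\<close> colours in \<open>A\<close>. At that moment
  fewer than \<open>k\<close> vertices have more than \<open>k\<close> colours in \<open>A\<close>; putting these into the first group
  leaves every other vertex with at least \<open>k * (m - 1)\<close> colours outside \<open>A\<close>.\<close>

text \<open>\<open>A\<close> is a finite set of least cardinality that gives at least
  \<open>k\<close> vertices \<open>k\<close> or more colours each. Dropping one colour costs a
  vertex at most one, so vertices with more than \<open>k\<close> colours in \<open>A\<close> stay
  satisfied; by minimality there are at most \<open>k\<close> of them, and they extend to
  \<open>T\<close> within the satisfied vertices.\<close>

lemma moving_knife: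
  fixes S :: "'a \<Rightarrow> 'c set"
  assumes "finite V" and fin: "\<And>v. v \<in> V \<Longrightarrow> finite (S v)"
    and ge: "\<And>v. v \<in> V \<Longrightarrow> k \<le> card (S v)" and "k \<le> card V"
  obtains A T where "T \<subseteq> V" "card T = k" "\<And>v. v \<in> T \<Longrightarrow> k \<le> card (S v \<inter> A)"
    "\<And>v. v \<in> V - T \<Longrightarrow> card (S v \<inter> A) \<le> k"
proof -
  define sat where "sat A = {v \<in> V. k \<le> card (S v \<inter> A)}" for A
  \<comment> \<open>Without finiteness, an infinite \<open>A\<close> would have
    \<open>card A = 0\<close> and win the minimisation.\<close>
  define P where "P A \<longleftrightarrow> finite A \<and> k \<le> card (sat A)" for A
  have "S v \<inter> \<Union>(S ` V) = S v" if "v \<in> V" for v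
    using that by blast
  then have "sat (\<Union>(S ` V)) = V"
    using ge by (auto simp: sat_def)
  then have "P (\<Union>(S ` V))"
    using assms by (simp add: P_def)
  then obtain A where "P A" and min: "\<And>B. P B \<Longrightarrow> card A \<le> card B"
    using ex_has_least_nat[of P _ card] by blast
  have "finite A" and kA: "k \<le> card (sat A)"
    using \<open>P A\<close> by (auto simp: P_def)
  define over where "over = {v \<in> V. k < card (S v \<inter> A)}"
  have "card over \<le> k"
  proof (cases "A = {}")
    case True
    then show ?thesis by (simp add: over_def)
  next
    case False
    then obtain a where "a \<in> A" by blast
    have "over \<subseteq> sat (A - {a})"
    proof
      fix v assume v: "v \<in> over"
      have "S v \<inter> (A - {a}) = (S v \<inter> A) - {a}" by blast
      then have "card (S v \<inter> A) - 1 \<le> card (S v \<inter> (A - {a}))"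
        by (simp add: card_Diff_singleton_if)
      then show "v \<in> sat (A - {a})"
        using v by (auto simp: over_def sat_def)
    qed
    moreover have "card (sat (A - {a})) < k"
    proof (rule ccontr)
      assume "\<not> ?thesis"
      then have "card A \<le> card (A - {a})"
        using \<open>finite A\<close> by (intro min) (simp add: P_def)
      then show False
        using card_Diff1_less[OF \<open>finite A\<close> \<open>a \<in> A\<close>] by simp
    qed
    moreover have "finite (sat (A - {a}))"
      using \<open>finite V\<close> by (simp add: sat_def)
    ultimately show ?thesis
      using card_mono by (metis less_imp_le order.trans)
  qed
  moreover have "over \<subseteq> sat A" "finite (sat A)"
    using \<open>finite V\<close> by (auto simp: over_def sat_def)
  ultimately obtain T where "over \<subseteq> T" "T \<subseteq> sat A" "card T = k"
    using kA exists_subset_between by metis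
  then show thesis
    by (intro that[of T A]) (auto simp: over_def sat_def not_less)
qed

text \<open>\<open>g\<close> gives the group of a vertex, \<open>f\<close> the group owning a
  colour. By induction on \<open>m\<close>, \<open>moving_knife\<close> yields group
  \<open>m\<close> and its share \<open>A\<close>; the rest is handled with the lists
  \<open>S v - A\<close>. Their sizes may differ, hence only a lower bound on
  \<open>card (S v)\<close>.\<close>

lemma split_lists:
  fixes S :: "'a \<Rightarrow> 'c set"
  assumes "finite V" "card V \<le> k * m"
    and "\<And>v. v \<in> V \<Longrightarrow> finite (S v)" "\<And>v. v \<in> V \<Longrightarrow> k * m \<le> card (S v)"
  shows "\<exists>(g :: 'a \<Rightarrow> nat) (f :: 'c \<Rightarrow> nat). (\<forall>j. card {v \<in> V. g v = j} \<le> k) \<and>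
    (\<forall>v \<in> V. g v < m \<and> k \<le> card {x \<in> S v. f x = g v})"
  using assms
proof (induction m arbitrary: V S)
  case 0
  then show ?case by auto
next
  case (Suc m)
  show ?case
  proof (cases "card V \<le> k")
    \<comment> \<open>Too few vertices for \<open>moving_knife\<close>: a single group receives all
      the colours.\<close>
    case True
    have "card {v \<in> V. m = j} \<le> k" for j
      using True by (cases "m = j") auto
    moreover have "k \<le> card {x \<in> S v. m = m}" if "v \<in> V" for v
      using Suc.prems(4)[OF that] by simp
    ultimately show ?thesis
      by (intro exI[of _ "\<lambda>_. m"]) auto
  next
    case False
    have "k \<le> card (S v)" if "v \<in> V" for v
      using Suc.prems(4)[OF that] by simp
    then obtain A T where T: "T \<subseteq> V" "card T = k" "\<And>v. v \<in> T \<Longrightarrow> k \<le> card (S v \<inter> A)"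
      "\<And>v. v \<in> V - T \<Longrightarrow> card (S v \<inter> A) \<le> k"
      using moving_knife[of V S k] Suc.prems False by (metis nat_le_linear)
    have "finite T"
      using T(1) Suc.prems(1) by (rule finite_subset)
    then have "card (V - T) \<le> k * m"
      using T Suc.prems by (simp add: card_Diff_subset)
    moreover have "k * m \<le> card (S v - A)" if v: "v \<in> V - T" for v
    proof -
      have "card (S v) = card (S v - A) + card (S v \<inter> A)"
        using Suc.prems(3) v by (metis DiffD1 add.commute card_Int_Diff)
      then show ?thesis
        using T(4)[OF v] Suc.prems(4)[of v] v by simp
    qed
    ultimately have "\<exists>(g :: 'a \<Rightarrow> nat) (f :: 'c \<Rightarrow> nat).
        (\<forall>j. card {v \<in> V - T. g v = j} \<le> k) \<and>
        (\<forall>v \<in> V - T. g v < m \<and> k \<le> card {x \<in> S v - A. f x = g v})"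
      using Suc.prems by (intro Suc.IH) auto
    then obtain g f where gf: "\<And>j. card {v \<in> V - T. g v = j} \<le> k"
      "\<And>v. v \<in> V - T \<Longrightarrow> g v < m \<and> k \<le> card {x \<in> S v - A. f x = g v}"
      by blast
    define g' where "g' v = (if v \<in> T then m else g v)" for v
    \<comment> \<open>Colours outside \<open>A\<close> may also have value \<open>m\<close> under
      \<open>f\<close>; this only enlarges the share of group \<open>m\<close>.\<close>
    define f' where "f' x = (if x \<in> A then m else f x)" for x
    have "card {v \<in> V. g' v = j} \<le> k" for j
    proof (cases "j = m")
      case True
      then have "{v \<in> V. g' v = j} = T"
        using T(1) gf(2) by (auto simp: g'_def split: if_splits)
      then show ?thesis using T(2) by simp
    next
      case False
      then have "{v \<in> V. g' v = j} = {v \<in> V - T. g v = j}"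
        by (auto simp: g'_def)
      then show ?thesis using gf(1) by simp
    qed
    moreover have "g' v < Suc m \<and> k \<le> card {x \<in> S v. f' x = g' v}" if v: "v \<in> V" for v
    proof (cases "v \<in> T")
      case True
      have "S v \<inter> A \<subseteq> {x \<in> S v. f' x = g' v}"
        using True by (auto simp: f'_def g'_def)
      then have "card (S v \<inter> A) \<le> card {x \<in> S v. f' x = g' v}"
        using Suc.prems(3)[OF v] by (intro card_mono) auto
      then show ?thesis
        using T(3)[OF True] True by (simp add: g'_def)
    next
      case False
      have "{x \<in> S v - A. f x = g v} \<subseteq> {x \<in> S v. f' x = g' v}"
        using False by (auto simp: f'_def g'_def)
      then have "card {x \<in> S v - A. f x = g v} \<le> card {x \<in> S v. f' x = g' v}"
        using Suc.prems(3)[OF v] by (intro card_mono) auto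
      then show ?thesis
        using gf(2)[of v] False v by (auto simp: g'_def)
    qed
    ultimately show ?thesis by blast
  qed
qed

theorem theorem8:
  fixes G :: "'a pair_pre_digraph" and k m :: nat
  assumes "pair_graph G" and "k \<ge> 1" and "strongly_choosable k G" and "m \<ge> 1"
  shows "strongly_choosable (k * m) G"
  unfolding strongly_choosable_def choosable_def
proof (intro allI impI, elim conjE)
  fix r :: nat and V :: "nat \<Rightarrow> 'a set" and S :: "'a \<Rightarrow> nat set"
  assume V: "\<forall>i\<in>{1..r}. V i \<subseteq> pverts G \<and> finite (V i) \<and> card (V i) \<le> k * m"
    and disj: "disjoint_family_on V {1..r}"
    and "\<forall>v\<in>pverts (add_cliques G {1..r} V). finite (S v) \<and> card (S v) = k * m"
  then have S: "finite (S v)" "card (S v) = k * m" if "v \<in> pverts G" for v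
    using that by (auto simp: add_cliques_def)
  \<comment> \<open>The splittings of different \<open>V i\<close> can be chosen independently,
    since no vertex lies in two of them.\<close>
  have "\<forall>i\<in>{1..r}. \<exists>(g :: 'a \<Rightarrow> nat) (f :: nat \<Rightarrow> nat). (\<forall>j. card {v \<in> V i. g v = j} \<le> k) \<and>
      (\<forall>v \<in> V i. g v < m \<and> k \<le> card {x \<in> S v. f x = g v})"
  proof
    fix i assume "i \<in> {1..r}"
    then show "\<exists>(g :: 'a \<Rightarrow> nat) (f :: nat \<Rightarrow> nat). (\<forall>j. card {v \<in> V i. g v = j} \<le> k) \<and>
      (\<forall>v \<in> V i. g v < m \<and> k \<le> card {x \<in> S v. f x = g v})"
      using V S by (intro split_lists) (auto simp: subset_iff)
  qed
  from bchoice[OF this] obtain g :: "nat \<Rightarrow> 'a \<Rightarrow> nat" where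
    "\<forall>i\<in>{1..r}. \<exists>f :: nat \<Rightarrow> nat. (\<forall>j. card {v \<in> V i. g i v = j} \<le> k) \<and>
      (\<forall>v \<in> V i. g i v < m \<and> k \<le> card {x \<in> S v. f x = g i v})"
    by blast
  from bchoice[OF this] obtain f :: "nat \<Rightarrow> nat \<Rightarrow> nat" where
    card_g: "\<And>i j. i \<in> {1..r} \<Longrightarrow> card {v \<in> V i. g i v = j} \<le> k" and
    g_less: "\<And>i v. i \<in> {1..r} \<Longrightarrow> v \<in> V i \<Longrightarrow> g i v < m" and
    lists: "\<And>i v. i \<in> {1..r} \<Longrightarrow> v \<in> V i \<Longrightarrow> k \<le> card {x \<in> S v. f i x = g i v}"
    by blast
  \<comment> \<open>By disjointness the last condition constrains \<open>L\<close> for at most one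
    \<open>i\<close>; a vertex outside all \<open>V i\<close> may take any \<open>k\<close> of its
    colours.\<close>
  define good where "good v L \<longleftrightarrow> L \<subseteq> S v \<and> finite L \<and> card L = k \<and>
      (\<forall>i\<in>{1..r}. v \<in> V i \<longrightarrow> L \<subseteq> {x. f i x = g i v})" for v L
  have "\<exists>L. good v L" if v: "v \<in> pverts G" for v
  proof (cases "\<exists>i\<in>{1..r}. v \<in> V i")
    case True
    then obtain i where i: "i \<in> {1..r}" "v \<in> V i" by blast
    obtain L where "L \<subseteq> {x \<in> S v. f i x = g i v}" "card L = k" "finite L"
      using obtain_subset_with_card_n[OF lists[OF i]] by metis
    moreover have "i' = i" if "i' \<in> {1..r}" "v \<in> V i'" for i'
      using disj that i unfolding disjoint_family_on_def by blast
    ultimately show ?thesis unfolding good_def by blast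
  next
    case False
    have "k \<le> card (S v)"
      using S(2)[OF v] \<open>m \<ge> 1\<close> by simp
    then obtain L where "L \<subseteq> S v" "card L = k" "finite L"
      using obtain_subset_with_card_n by metis
    then show ?thesis
      using False unfolding good_def by blast
  qed
  then obtain L where "\<And>v. v \<in> pverts G \<Longrightarrow> good v (L v)"
    by metis
  then have L: "\<And>v. v \<in> pverts G \<Longrightarrow> L v \<subseteq> S v"
    "\<And>v. v \<in> pverts G \<Longrightarrow> finite (L v) \<and> card (L v) = k"
    "\<And>v i. v \<in> pverts G \<Longrightarrow> i \<in> {1..r} \<Longrightarrow> v \<in> V i \<Longrightarrow> L v \<subseteq> {x. f i x = g i v}"
    unfolding good_def by blast+
  \<comment> \<open>Group \<open>j < m\<close> of \<open>V i\<close> gets the index \<open>(i - 1) * m + j + 1\<close>.\<close>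
  define q where "q p = (p - 1) div m + 1" for p
  define W where "W p = {v \<in> V (q p). g (q p) v = (p - 1) mod m}" for p
  have q: "q p \<in> {1..r}" if "p \<in> {1..r * m}" for p
  proof -
    have "p - 1 < r * m" using that by auto
    then have "(p - 1) div m < r" by (rule less_mult_imp_div_less)
    then show ?thesis by (simp add: q_def)
  qed
  have W: "W p \<subseteq> pverts G \<and> finite (W p) \<and> card (W p) \<le> k" if "p \<in> {1..r * m}" for p
    using V q[OF that] card_g[OF q[OF that]] by (auto simp: W_def)
  have "disjoint_family_on W {1..r * m}"
    unfolding disjoint_family_on_def
  proof (intro ballI impI, rule ccontr)
    fix p p' assume p: "p \<in> {1..r * m}" "p' \<in> {1..r * m}" "p \<noteq> p'" "W p \<inter> W p' \<noteq> {}"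
    then obtain v where v: "v \<in> W p" "v \<in> W p'" by blast
    then have "q p = q p'"
      using disj q[OF p(1)] q[OF p(2)] unfolding disjoint_family_on_def W_def by blast
    moreover from this have "(p - 1) mod m = (p' - 1) mod m"
      using v by (auto simp: W_def)
    \<comment> \<open>Quotient and remainder by \<open>m\<close> determine \<open>p - 1\<close>,
      hence \<open>p\<close>, because the indices start at 1.\<close>
    ultimately have "p - 1 = p' - 1"
      by (metis q_def add_right_cancel div_mult_mod_eq)
    then show False using p by auto
  qed
  then have "choosable k (add_cliques G {1..r * m} W)"
    using assms(3) W by (auto simp: strongly_choosable_def)
  moreover have verts: "pverts (add_cliques G {1..r * m} W) = pverts G"
    by (simp add: add_cliques_def)
  ultimately obtain c where c: "proper_colouring (add_cliques G {1..r * m} W) c"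
    and cL: "\<And>v. v \<in> pverts G \<Longrightarrow> c v \<in> L v"
    using choosable_def[THEN iffD1, rule_format, of k "add_cliques G {1..r * m} W" L] L(2) verts
    by auto
  have "c u \<noteq> c v" if uv: "u \<noteq> v" "i \<in> {1..r}" "u \<in> V i" "v \<in> V i" for u v i
  \<comment> \<open>Vertices of the same group are adjacent through some \<open>W p\<close>; for
    different groups, \<open>f i\<close> separates the lists \<open>L u\<close> and
    \<open>L v\<close>.\<close>
  proof (cases "g i u = g i v")
    case True
    define p where "p = (i - 1) * m + g i u + 1"
    have g: "g i u < m" using g_less uv by blast
    have "q p = i" "(p - 1) mod m = g i u"
      using g uv(2) by (auto simp: p_def q_def)
    then have "u \<in> W p" "v \<in> W p"
      using uv True by (auto simp: W_def)
    moreover have "p \<in> {1..r * m}"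
    proof -
      have "p \<le> (i - 1) * m + m" using g by (simp add: p_def)
      also have "\<dots> = i * m" using uv(2) by (cases i) auto
      also have "\<dots> \<le> r * m" using uv(2) by simp
      finally show ?thesis by (simp add: p_def)
    qed
    ultimately have "(u, v) \<in> parcs (add_cliques G {1..r * m} W)"
      using uv(1) by (auto simp: add_cliques_def)
    then show ?thesis
      using c by (auto simp: proper_colouring_def)
  next
    case False
    have "u \<in> pverts G" "v \<in> pverts G"
      using V uv by auto
    then have "f i (c u) = g i u" "f i (c v) = g i v"
      using L(3) cL uv by blast+
    then show ?thesis using False by auto
  qed
  moreover have "c u \<noteq> c v" if "(u, v) \<in> parcs G" for u v
    using c that by (fastforce simp: proper_colouring_def add_cliques_def)
  ultimately have "proper_colouring (add_cliques G {1..r} V) c"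
    by (auto simp: proper_colouring_def add_cliques_def)
  moreover have "\<forall>v\<in>pverts (add_cliques G {1..r} V). c v \<in> S v"
    using cL L(1) by (auto simp: add_cliques_def)
  ultimately show "\<exists>c. proper_colouring (add_cliques G {1..r} V) c \<and>
      (\<forall>v\<in>pverts (add_cliques G {1..r} V). c v \<in> S v)"
    by blast
qed

end
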